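(* Let $X$ be a Hausdorff zero-dimensional space. The following two statements are equivalent: (1) $X$ is pseudocompact. (2) The relative topology on $C_c^*(X)$ induced by the $m_c$-topology on $C_c(X)$ is identical to the uniform norm topology on $C_c^*(X)$.
   Context: A space is zero-dimensional if its clopen sets form a base for its topology. $X$ is pseudocompact if every real-valued continuous function on $X$ is bounded. $C_c(X)$ is the ring of real-valued continuous functions on $X$ with countable range, and $C_c^*(X)$ is the subring of bounded members of $C_c(X)$. The $m_c$-topology on $C_c(X)$ is the topology with open base consisting of all sets $M(g,u)=\{f\in C_c(X): |f(x)-g(x)|<u(x)\text{ for each }x\in X\}$, where $g\in C_c(X)$ and $u$ is a positive unit of $C_c(X)$ (a unit with $u(x)>0$ for all $x$). The uniform norm on $C_c^*(X)$ is $\|f\|=\sup_{x\in X}|f(x)|$. *)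

theory Defs
  imports "HOL-Analysis.Analysis"
begin

definition zero_dimensional_space :: "'a topology \<Rightarrow> bool" where
  "zero_dimensional_space X \<longleftrightarrow>
     openin X = arbitrary union_of (\<lambda>U. openin X U \<and> closedin X U)"

definition pseudocompact_space :: "'a topology \<Rightarrow> bool" where
  "pseudocompact_space X \<longleftrightarrow>
     (\<forall>f. continuous_map X euclideanreal f \<longrightarrow> bounded (f ` topspace X))"

text \<open>A real-valued function on the space is represented by its unique extension
  that is constantly \<open>undefined\<close> off the carrier, so that equality of representatives is
  equality of functions on the space.\<close>

definition Cc :: "'a topology \<Rightarrow> ('a \<Rightarrow> real) set" where
  "Cc X = {f \<in> extensional (topspace X).
             continuous_map X euclideanreal f \<and> countable (f ` topspace X)}"

definition Cc_star :: "'a topology \<Rightarrow> ('a \<Rightarrow> real) set" where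
  "Cc_star X = {f \<in> Cc X. bounded (f ` topspace X)}"

definition Cc_unit :: "'a topology \<Rightarrow> ('a \<Rightarrow> real) \<Rightarrow> bool" where
  "Cc_unit X u \<longleftrightarrow> u \<in> Cc X \<and> (\<exists>v \<in> Cc X. \<forall>x \<in> topspace X. u x * v x = 1)"

definition Cc_pos_unit :: "'a topology \<Rightarrow> ('a \<Rightarrow> real) \<Rightarrow> bool" where
  "Cc_pos_unit X u \<longleftrightarrow> Cc_unit X u \<and> (\<forall>x \<in> topspace X. 0 < u x)"

definition mc_basic :: "'a topology \<Rightarrow> ('a \<Rightarrow> real) \<Rightarrow> ('a \<Rightarrow> real) \<Rightarrow> ('a \<Rightarrow> real) set" where
  "mc_basic X g u = {f \<in> Cc X. \<forall>x \<in> topspace X. \<bar>f x - g x\<bar> < u x}"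

definition mc_base :: "'a topology \<Rightarrow> ('a \<Rightarrow> real) set \<Rightarrow> bool" where
  "mc_base X B \<longleftrightarrow> (\<exists>g u. g \<in> Cc X \<and> Cc_pos_unit X u \<and> B = mc_basic X g u)"

definition mc_topology :: "'a topology \<Rightarrow> ('a \<Rightarrow> real) topology" where
  "mc_topology X = topology (arbitrary union_of (mc_base X))"

text \<open>\<open>Sup\<close> on the reals is unspecified for empty and for unbounded sets; the value \<open>0\<close>
  is taken there. The unbounded case never arises for differences of members of \<open>Cc_star X\<close>,
  but the locale \<open>Metric_space\<close> asks for nonnegativity and symmetry off the carrier too.\<close>

definition uniform_norm :: "'a topology \<Rightarrow> ('a \<Rightarrow> real) \<Rightarrow> real" where
  "uniform_norm X f =
     (if topspace X \<noteq> {} \<and> bounded (f ` topspace X) then SUP x \<in> topspace X. \<bar>f x\<bar> else 0)"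

definition uniform_norm_topology :: "'a topology \<Rightarrow> ('a \<Rightarrow> real) topology" where
  "uniform_norm_topology X =
     Metric_space.mtopology (Cc_star X) (\<lambda>f g. uniform_norm X (\<lambda>x. f x - g x))"

text \<open>\<open>topology\<close> and \<open>Metric_space.mtopology\<close> have their intended meaning only
  under side conditions: that the sets of \<open>mc_base X\<close> do form a base, and that the uniform norm
  induces a metric on \<open>Cc_star X\<close>. The lemmas \<open>istopology_mc_base\<close> and
  \<open>Metric_space_uniform_norm\<close> below establish them.\<close>

lemma countable_image_binary:
  assumes "countable (f ` S)" "countable (g ` S)"
  shows "countable ((\<lambda>x. F (f x) (g x)) ` S)"
proof (rule countable_subset)
  show "(\<lambda>x. F (f x) (g x)) ` S \<subseteq> (\<lambda>(a, b). F a b) ` (f ` S \<times> g ` S)" by force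
qed (use assms in simp)

lemma Cc_binary:
  assumes "f \<in> Cc X" "g \<in> Cc X" "continuous_map X euclideanreal (\<lambda>x. F (f x) (g x))"
  shows "restrict (\<lambda>x. F (f x) (g x)) (topspace X) \<in> Cc X"
proof -
  have "continuous_map X euclideanreal (restrict (\<lambda>x. F (f x) (g x)) (topspace X))"
    using assms(3) by (rule continuous_map_eq) simp
  with assms countable_image_binary[of f "topspace X" g F] show ?thesis
    by (simp add: Cc_def)
qed

lemma Cc_pos_unitI:
  assumes u: "u \<in> Cc X" and pos: "\<And>x. x \<in> topspace X \<Longrightarrow> 0 < u x"
  shows "Cc_pos_unit X u"
proof -
  have "continuous_map X euclideanreal (\<lambda>x. inverse (u x))"
    using u pos by (intro continuous_map_real_inverse) (force simp: Cc_def)+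
  then have "restrict (\<lambda>x. inverse (u x)) (topspace X) \<in> Cc X"
    using Cc_binary[OF u u, of "\<lambda>a b. inverse a"] by simp
  moreover have "\<forall>x \<in> topspace X. u x * restrict (\<lambda>x. inverse (u x)) (topspace X) x = 1"
    using pos by force
  ultimately show ?thesis
    using u pos unfolding Cc_pos_unit_def Cc_unit_def by blast
qed

lemma mc_basic_centred:
  assumes g: "g \<in> Cc X" and u: "Cc_pos_unit X u" and f: "f \<in> mc_basic X g u"
  obtains w where "Cc_pos_unit X w" "mc_basic X f w \<subseteq> mc_basic X g u"
proof -
  define d where "d = restrict (\<lambda>x. \<bar>f x - g x\<bar>) (topspace X)"
  define w where "w = restrict (\<lambda>x. u x - d x) (topspace X)"
  have fC: "f \<in> Cc X" and uC: "u \<in> Cc X"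
    using f u by (auto simp: mc_basic_def Cc_pos_unit_def Cc_unit_def)
  have dC: "d \<in> Cc X"
    unfolding d_def using fC g
    by (intro Cc_binary[where F = "\<lambda>a b. \<bar>a - b\<bar>"] continuous_map_real_abs continuous_map_diff)
       (auto simp: Cc_def)
  have "w \<in> Cc X"
    unfolding w_def using uC dC
    by (intro Cc_binary[where F = "\<lambda>a b. a - b"] continuous_map_diff) (auto simp: Cc_def)
  then have "Cc_pos_unit X w"
    using f by (intro Cc_pos_unitI) (auto simp: w_def d_def mc_basic_def)
  moreover have "mc_basic X f w \<subseteq> mc_basic X g u"
    by (force simp: mc_basic_def w_def d_def)
  ultimately show ?thesis using that by blast
qed

lemma istopology_mc_base: "istopology (arbitrary union_of (mc_base X))"
  unfolding istopology_base_eq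
proof (intro allI impI)
  fix S T assume "mc_base X S \<and> mc_base X T"
  then obtain g u h v where S: "S = mc_basic X g u" "g \<in> Cc X" "Cc_pos_unit X u"
    and T: "T = mc_basic X h v" "h \<in> Cc X" "Cc_pos_unit X v"
    unfolding mc_base_def by blast
  have "\<exists>B. mc_base X B \<and> f \<in> B \<and> B \<subseteq> S \<inter> T" if f: "f \<in> S \<inter> T" for f
  proof -
    obtain a where a: "Cc_pos_unit X a" "mc_basic X f a \<subseteq> S"
      using mc_basic_centred f S by (metis IntD1)
    obtain b where b: "Cc_pos_unit X b" "mc_basic X f b \<subseteq> T"
      using mc_basic_centred f T by (metis IntD2)
    define w where "w = restrict (\<lambda>x. min (a x) (b x)) (topspace X)"
    have fC: "f \<in> Cc X" using f S by (simp add: mc_basic_def)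
    have "w \<in> Cc X"
      unfolding w_def using a b
      by (intro Cc_binary[where F = min] continuous_map_real_min)
         (auto simp: Cc_pos_unit_def Cc_unit_def Cc_def)
    then have w: "Cc_pos_unit X w"
      using a b by (intro Cc_pos_unitI) (auto simp: w_def Cc_pos_unit_def)
    have "mc_basic X f w \<subseteq> mc_basic X f a" "mc_basic X f w \<subseteq> mc_basic X f b"
      by (auto simp: mc_basic_def w_def)
    moreover have "f \<in> mc_basic X f w" using fC w by (simp add: mc_basic_def Cc_pos_unit_def)
    ultimately show ?thesis
      using a b fC w unfolding mc_base_def by blast
  qed
  then show "(arbitrary union_of mc_base X) (S \<inter> T)"
    unfolding arbitrary_union_of_alt by blast
qed

lemma openin_mc_topology: "openin (mc_topology X) = arbitrary union_of (mc_base X)"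
  unfolding mc_topology_def using istopology_mc_base by (rule topology_inverse')

lemma uniform_norm_le_iff:
  assumes "bounded (f ` topspace X)" "0 \<le> c"
  shows "uniform_norm X f \<le> c \<longleftrightarrow> (\<forall>x \<in> topspace X. \<bar>f x\<bar> \<le> c)"
proof (cases "topspace X = {}")
  case False
  have "bdd_above ((\<lambda>x. \<bar>f x\<bar>) ` topspace X)"
    using assms(1) unfolding bounded_iff bdd_above_def by auto
  then show ?thesis
    using assms False by (simp add: uniform_norm_def cSUP_le_iff)
qed (use assms in \<open>simp add: uniform_norm_def\<close>)

lemma uniform_norm_nonneg: "0 \<le> uniform_norm X f"
proof (cases "topspace X \<noteq> {} \<and> bounded (f ` topspace X)")
  case True
  then obtain x where x: "x \<in> topspace X" by blast
  have "bdd_above ((\<lambda>x. \<bar>f x\<bar>) ` topspace X)"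
    using True unfolding bounded_iff bdd_above_def by auto
  then have "\<bar>f x\<bar> \<le> (SUP x \<in> topspace X. \<bar>f x\<bar>)" using x by (rule cSUP_upper2) simp
  then show ?thesis using True by (simp add: uniform_norm_def)
qed (auto simp: uniform_norm_def)

lemma abs_le_uniform_norm:
  "bounded (f ` topspace X) \<Longrightarrow> x \<in> topspace X \<Longrightarrow> \<bar>f x\<bar> \<le> uniform_norm X f"
  using uniform_norm_le_iff[OF _ uniform_norm_nonneg] by blast

lemma Metric_space_uniform_norm:
  "Metric_space (Cc_star X) (\<lambda>f g. uniform_norm X (\<lambda>x. f x - g x))"
proof
  fix f g :: "'a \<Rightarrow> real"
  show "0 \<le> uniform_norm X (\<lambda>x. f x - g x)" by (rule uniform_norm_nonneg)
  show "uniform_norm X (\<lambda>x. f x - g x) = uniform_norm X (\<lambda>x. g x - f x)"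
    unfolding uniform_norm_def bounded_iff ball_simps real_norm_def
    by (subst (1 2) abs_minus_commute) (rule refl)
next
  have bd: "bounded ((\<lambda>x. f x - g x) ` topspace X)" if "f \<in> Cc_star X" "g \<in> Cc_star X" for f g
    using that by (intro bounded_minus_comp) (auto simp: Cc_star_def)
  fix f g assume fg: "f \<in> Cc_star X" "g \<in> Cc_star X"
  show "uniform_norm X (\<lambda>x. f x - g x) = 0 \<longleftrightarrow> f = g"
  proof -
    have "uniform_norm X (\<lambda>x. f x - g x) = 0 \<longleftrightarrow> (\<forall>x \<in> topspace X. f x = g x)"
      using uniform_norm_le_iff[OF bd[OF fg], of 0] uniform_norm_nonneg[of X "\<lambda>x. f x - g x"]
      by auto
    also have "\<dots> \<longleftrightarrow> f = g"
      using fg by (auto simp: Cc_star_def Cc_def intro: extensionalityI)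
    finally show ?thesis .
  qed
  fix h assume h: "h \<in> Cc_star X"
  show "uniform_norm X (\<lambda>x. f x - h x)
          \<le> uniform_norm X (\<lambda>x. f x - g x) + uniform_norm X (\<lambda>x. g x - h x)"
  proof (subst uniform_norm_le_iff[OF bd[OF fg(1) h]], goal_cases)
    case 2
    show ?case
    proof
      fix x assume "x \<in> topspace X"
      then show "\<bar>f x - h x\<bar>
          \<le> uniform_norm X (\<lambda>x. f x - g x) + uniform_norm X (\<lambda>x. g x - h x)"
        using abs_le_uniform_norm[OF bd[OF fg]] abs_le_uniform_norm[OF bd[OF fg(2) h]]
        by (smt (verit))
    qed
  qed (simp add: uniform_norm_nonneg)
qed

end

theory Submission
  imports Defs
begin

text \<open>On a pseudocompact space the inverse of a positive unit is bounded, so a positive unit is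
  bounded below by a positive constant and every \<open>m\<^sub>c\<close>-neighbourhood contains a uniform ball.
  Conversely, let \<open>f\<close> be continuous and unbounded, and choose nonempty clopen sets
  \<open>V n \<subseteq> {\<bar>f\<bar> > n}\<close>. They form a locally finite family, so \<open>{n. x \<in> V n}\<close> is finite
  and locally constant in \<open>x\<close>, and \<open>u x = 1 / (1 + \<Sum>{n. x \<in> V n})\<close> is a positive unit of
  countable range with infimum \<open>0\<close>. No uniform ball about \<open>0\<close> fits into \<open>M(0, u)\<close>, because it
  contains small positive constants.\<close>

text \<open>With each of its points, the preimage of any set contains a neighbourhood on which
  \<open>u\<close> is constant. The topology of \<open>Y\<close> plays no part, so no continuity
  estimate for the sum defining the small unit below has to be made.\<close>

lemma continuous_map_locally_constant:
  assumes "\<And>x. x \<in> topspace X \<Longrightarrow> \<exists>N. openin X N \<and> x \<in> N \<and> (\<forall>y \<in> N. u y = u x)"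
    and "u ` topspace X \<subseteq> topspace Y"
  shows "continuous_map X Y u"
  unfolding continuous_map_def
proof (intro conjI allI impI)
  fix U assume "openin Y U"
  show "openin X {x \<in> topspace X. u x \<in> U}"
  proof (subst openin_subopen, clarify)
    fix x assume x: "x \<in> topspace X" "u x \<in> U"
    obtain N where N: "openin X N" "x \<in> N" "\<forall>y \<in> N. u y = u x"
      using assms(1)[OF x(1)] by (elim exE conjE)
    have "y \<in> {x \<in> topspace X. u x \<in> U}" if y: "y \<in> N" for y
    proof -
      have "u y = u x" using N(3) y by (rule bspec)
      then show ?thesis using \<open>u x \<in> U\<close> y openin_subset[OF N(1)] by auto
    qed
    with N(1,2) show "\<exists>T. openin X T \<and> x \<in> T \<and> T \<subseteq> {x \<in> topspace X. u x \<in> U}"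
      by blast
  qed
qed (use assms(2) in blast)

lemma Cc_const: "restrict (\<lambda>_. c) (topspace X) \<in> Cc X"
proof -
  have "countable ((\<lambda>_. c) ` topspace X)"
    by (rule countable_subset[of _ "{c}"]) auto
  moreover have "continuous_map X euclideanreal (restrict (\<lambda>_. c) (topspace X))"
    by (rule continuous_map_eq[of X _ "\<lambda>_. c"]) auto
  ultimately show ?thesis by (simp add: Cc_def)
qed

lemma Cc_star_const: "restrict (\<lambda>_. c) (topspace X) \<in> Cc_star X"
  using Cc_const[of c X] by (auto simp: Cc_star_def bounded_iff)

text \<open>By \<open>mc_basic_centred\<close>, a basic set around \<open>f\<close> can be shrunk to
  one centred at \<open>f\<close>. This puts openness in the same form as for a metric, with
  positive units in place of radii.\<close>

lemma openin_mc_subtopology: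
  "openin (subtopology (mc_topology X) (Cc_star X)) S \<longleftrightarrow>
     S \<subseteq> Cc_star X \<and> (\<forall>f \<in> S. \<exists>u. Cc_pos_unit X u \<and> mc_basic X f u \<inter> Cc_star X \<subseteq> S)"
proof safe
  assume "openin (subtopology (mc_topology X) (Cc_star X)) S"
  then obtain T where T: "(arbitrary union_of mc_base X) T" and S: "S = T \<inter> Cc_star X"
    by (auto simp: openin_subtopology openin_mc_topology)
  show "f \<in> Cc_star X" if "f \<in> S" for f using that S by blast
  fix f assume "f \<in> S"
  with T S obtain B where B: "mc_base X B" "f \<in> B" "B \<subseteq> T"
    unfolding arbitrary_union_of_alt by blast
  then obtain w where "Cc_pos_unit X w" "mc_basic X f w \<subseteq> B"
    unfolding mc_base_def by (metis mc_basic_centred)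
  with B S show "\<exists>u. Cc_pos_unit X u \<and> mc_basic X f u \<inter> Cc_star X \<subseteq> S" by blast
next
  assume S: "S \<subseteq> Cc_star X"
    and nb: "\<forall>f \<in> S. \<exists>u. Cc_pos_unit X u \<and> mc_basic X f u \<inter> Cc_star X \<subseteq> S"
  \<comment> \<open>The largest candidate for an open set of \<open>Cc X\<close> with trace
    \<open>S\<close>: the union of all basic sets whose trace stays inside \<open>S\<close>.\<close>
  define \<B> where "\<B> = {B. mc_base X B \<and> B \<inter> Cc_star X \<subseteq> S}"
  have "openin (mc_topology X) (\<Union>\<B>)"
    by (intro openin_Union) (auto simp: openin_mc_topology \<B>_def arbitrary_union_of_inc)
  moreover have "S = \<Union>\<B> \<inter> Cc_star X"
  proof
    show "S \<subseteq> \<Union>\<B> \<inter> Cc_star X"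
    proof
      fix f assume f: "f \<in> S"
      with nb obtain u where u: "Cc_pos_unit X u" "mc_basic X f u \<inter> Cc_star X \<subseteq> S" by blast
      have fC: "f \<in> Cc X" using f S by (auto simp: Cc_star_def)
      then have "mc_basic X f u \<in> \<B>" using u unfolding \<B>_def mc_base_def by blast
      moreover have "f \<in> mc_basic X f u"
        using fC u by (simp add: mc_basic_def Cc_pos_unit_def)
      ultimately show "f \<in> \<Union>\<B> \<inter> Cc_star X" using f S by blast
    qed
  qed (auto simp: \<B>_def)
  ultimately show "openin (subtopology (mc_topology X) (Cc_star X)) S"
    unfolding openin_subtopology by blast
qed

text \<open>Norm balls and sets given by a strict pointwise bound differ, since a supremum may equal
  \<open>r\<close> without being attained, but each contains one of the other kind. The pointwise
  form is directly comparable with \<open>mc_basic\<close>.\<close>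

lemma openin_uniform_norm_topology:
  "openin (uniform_norm_topology X) S \<longleftrightarrow>
     S \<subseteq> Cc_star X \<and>
     (\<forall>f \<in> S. \<exists>r > 0. \<forall>g \<in> Cc_star X. (\<forall>x \<in> topspace X. \<bar>g x - f x\<bar> < r) \<longrightarrow> g \<in> S)"
proof -
  interpret Metric_space "Cc_star X" "\<lambda>f g. uniform_norm X (\<lambda>x. f x - g x)"
    by (rule Metric_space_uniform_norm)
  have bd: "bounded ((\<lambda>x. f x - g x) ` topspace X)" if "f \<in> Cc_star X" "g \<in> Cc_star X" for f g
    using that by (intro bounded_minus_comp) (auto simp: Cc_star_def)
  have *: "(\<exists>r > 0. mball f r \<subseteq> S) \<longleftrightarrow>
      (\<exists>r > 0. \<forall>g \<in> Cc_star X. (\<forall>x \<in> topspace X. \<bar>g x - f x\<bar> < r) \<longrightarrow> g \<in> S)"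
    if f: "f \<in> Cc_star X" for f
  proof safe
    fix r :: real assume r: "0 < r" "mball f r \<subseteq> S"
    \<comment> \<open>Halving the radius restores strictness: a pointwise bound below
      \<open>r / 2\<close> only gives norm at most \<open>r / 2\<close>.\<close>
    have "g \<in> S" if g: "g \<in> Cc_star X" "\<forall>x \<in> topspace X. \<bar>g x - f x\<bar> < r / 2" for g
    proof -
      have "uniform_norm X (\<lambda>x. f x - g x) \<le> r / 2"
        using g r by (subst uniform_norm_le_iff[OF bd[OF f g(1)]])
          (auto simp: abs_minus_commute less_imp_le)
      with r f g show ?thesis by (auto simp: in_mball subset_iff)
    qed
    with r show "\<exists>r > 0. \<forall>g \<in> Cc_star X. (\<forall>x \<in> topspace X. \<bar>g x - f x\<bar> < r) \<longrightarrow> g \<in> S"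
      by (intro exI[of _ "r / 2"]) auto
  next
    fix r :: real
    assume r: "0 < r"
      "\<forall>g \<in> Cc_star X. (\<forall>x \<in> topspace X. \<bar>g x - f x\<bar> < r) \<longrightarrow> g \<in> S"
    have "g \<in> S" if "g \<in> mball f r" for g
    proof -
      have g: "g \<in> Cc_star X" "uniform_norm X (\<lambda>x. f x - g x) < r"
        using that by (auto simp: in_mball)
      then have "\<bar>g x - f x\<bar> < r" if "x \<in> topspace X" for x
        using abs_le_uniform_norm[OF bd[OF f g(1)] that] by linarith
      with r g show ?thesis by blast
    qed
    with r show "\<exists>r > 0. mball f r \<subseteq> S" by blast
  qed
  \<comment> \<open>Unfolding only the quantifier over \<open>S\<close> lets the congruence rules
    provide \<open>S \<subseteq> Cc_star X\<close> and \<open>f \<in> S\<close>, hence the premise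
    of \<open>*\<close>.\<close>
  show ?thesis
    unfolding uniform_norm_topology_def openin_mtopology Ball_def[of S]
    by (intro conj_cong all_cong1 imp_cong refl *) (erule subsetD)
qed

text \<open>Positive constants are positive units, so this inclusion holds on every space; only the
  reverse one is tied to pseudocompactness.\<close>

lemma uniform_norm_topology_imp_mc:
  assumes "openin (uniform_norm_topology X) S"
  shows "openin (subtopology (mc_topology X) (Cc_star X)) S"
  unfolding openin_mc_subtopology
proof (intro conjI ballI)
  show "S \<subseteq> Cc_star X" using assms by (simp add: openin_uniform_norm_topology)
  fix f assume "f \<in> S"
  then obtain r :: real where r: "r > 0"
    "\<forall>g \<in> Cc_star X. (\<forall>x \<in> topspace X. \<bar>g x - f x\<bar> < r) \<longrightarrow> g \<in> S"
    using assms unfolding openin_uniform_norm_topology by blast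
  let ?u = "restrict (\<lambda>_. r) (topspace X)"
  have "Cc_pos_unit X ?u" using r by (intro Cc_pos_unitI Cc_const) auto
  moreover have "mc_basic X f ?u \<inter> Cc_star X \<subseteq> S" using r(2) by (auto simp: mc_basic_def)
  ultimately show "\<exists>u. Cc_pos_unit X u \<and> mc_basic X f u \<inter> Cc_star X \<subseteq> S" by blast
qed

text \<open>A bound \<open>M\<close> on the inverse of \<open>u\<close> gives the lower bound
  \<open>1 / M\<close> for \<open>u\<close>.\<close>

lemma Cc_pos_unit_bounded_below:
  assumes "pseudocompact_space X" "Cc_pos_unit X u"
  obtains r where "0 < r" "\<And>x. x \<in> topspace X \<Longrightarrow> r \<le> u x"
proof -
  obtain v where v: "v \<in> Cc X" "\<forall>x \<in> topspace X. u x * v x = 1" and pos: "\<forall>x \<in> topspace X. 0 < u x"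
    using assms(2) unfolding Cc_pos_unit_def Cc_unit_def by blast
  then have "bounded (v ` topspace X)"
    using assms(1) by (auto simp: pseudocompact_space_def Cc_def)
  then obtain M where M: "0 < M" "\<And>x. x \<in> topspace X \<Longrightarrow> \<bar>v x\<bar> \<le> M"
    unfolding bounded_pos by auto
  have "1 / M \<le> u x" if x: "x \<in> topspace X" for x
  proof -
    have "1 = u x * v x" using v x by simp
    also have "\<dots> \<le> u x * M" using pos M(2)[OF x] x by (intro mult_left_mono) force+
    finally show ?thesis using M by (simp add: divide_le_eq)
  qed
  with M that[of "1 / M"] show ?thesis by simp
qed

lemma zero_dimensional_clopen_nbhd:
  assumes "zero_dimensional_space X" "openin X W" "x \<in> W"
  obtains V where "openin X V" "closedin X V" "x \<in> V" "V \<subseteq> W"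
proof -
  have "(arbitrary union_of (\<lambda>U. openin X U \<and> closedin X U)) W"
    using assms by (simp add: zero_dimensional_space_def)
  then show ?thesis using assms(3) that unfolding arbitrary_union_of_alt by blast
qed

lemma Cc_pos_unit_arbitrarily_small:
  assumes zd: "zero_dimensional_space X" and np: "\<not> pseudocompact_space X"
  obtains u where "Cc_pos_unit X u" "\<And>r. 0 < r \<Longrightarrow> \<exists>x \<in> topspace X. u x < r"
proof -
  obtain f where f: "continuous_map X euclideanreal f" "\<not> bounded (f ` topspace X)"
    using np by (auto simp: pseudocompact_space_def)
  have cf: "continuous_map X euclideanreal (\<lambda>x. \<bar>f x\<bar>)"
    using f(1) by (rule continuous_map_real_abs)
  have "\<exists>V. openin X V \<and> closedin X V \<and> V \<noteq> {} \<and> (\<forall>y \<in> V. real n < \<bar>f y\<bar>)" for n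
  proof -
    obtain x where x: "x \<in> topspace X" "real n < \<bar>f x\<bar>"
      using f(2) by (force simp: bounded_iff not_le)
    have "openin X {y \<in> topspace X. \<bar>f y\<bar> \<in> {real n<..}}"
      by (rule openin_continuous_map_preimage[OF cf]) simp
    then obtain V where "openin X V" "closedin X V" "x \<in> V"
      "V \<subseteq> {y \<in> topspace X. \<bar>f y\<bar> \<in> {real n<..}}"
      using x by (auto elim: zero_dimensional_clopen_nbhd[OF zd])
    then show ?thesis by blast
  qed
  then obtain V where V: "\<And>n. openin X (V n)" "\<And>n. closedin X (V n)" "\<And>n. V n \<noteq> {}"
    "\<And>n y. y \<in> V n \<Longrightarrow> real n < \<bar>f y\<bar>"
    by metis
  define A where "A x = {n. x \<in> V n}" for x
  \<comment> \<open>A sum of naturals is at least each of its terms and is \<open>0\<close> over the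
    empty set, so points outside every \<open>V n\<close> need no separate case, as they would with
    a maximum.\<close>
  define u where "u = restrict (\<lambda>x. 1 / (1 + real (\<Sum>(A x)))) (topspace X)"
  have finA: "finite (A x)" for x
  proof (rule finite_subset)
    show "A x \<subseteq> {..nat \<lceil>\<bar>f x\<bar>\<rceil>}"
    proof
      fix n assume "n \<in> A x"
      then have "real n < \<bar>f x\<bar>" using V(4) by (simp add: A_def)
      then show "n \<in> {..nat \<lceil>\<bar>f x\<bar>\<rceil>}" by simp linarith
    qed
  qed simp
  have loc: "\<exists>N. openin X N \<and> x \<in> N \<and> (\<forall>y \<in> N. A y = A x)" if x: "x \<in> topspace X" for x
  proof -
    \<comment> \<open>Where \<open>\<bar>f\<bar> < k\<close>, no point lies in \<open>V n\<close>
      for \<open>n \<ge> k\<close>. Only finitely many indices remain, and as each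
      \<open>V n\<close> is clopen, membership or non-membership of \<open>x\<close> persists on the
      open set \<open>C n\<close>.\<close>
    obtain k where k: "\<bar>f x\<bar> < real k" using reals_Archimedean2 by blast
    define C where "C n = (if x \<in> V n then V n else topspace X - V n)" for n
    define N where "N = {y \<in> topspace X. \<bar>f y\<bar> \<in> {..<real k}} \<inter> (\<Inter>n \<in> {..k}. C n)"
    have "openin X (\<Inter>n \<in> {..k}. C n)"
      using V(1,2) by (intro openin_INT2) (auto simp: C_def)
    moreover have "openin X {y \<in> topspace X. \<bar>f y\<bar> \<in> {..<real k}}"
      by (rule openin_continuous_map_preimage[OF cf]) simp
    ultimately have "openin X N" unfolding N_def by blast
    moreover have "x \<in> N" using x k by (auto simp: N_def C_def)
    moreover have "A y = A x" if y: "y \<in> N" for y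
    proof -
      have "y \<in> V n \<longleftrightarrow> x \<in> V n" for n
      proof (cases "n \<le> k")
        case True
        then have "y \<in> C n" using y by (simp add: N_def)
        then show ?thesis by (auto simp: C_def split: if_splits)
      next
        case False
        then have "\<not> real n < \<bar>f y\<bar>" "\<not> real n < \<bar>f x\<bar>" using y k by (auto simp: N_def)
        then show ?thesis using V(4) by blast
      qed
      then show ?thesis by (simp add: A_def)
    qed
    ultimately show ?thesis by blast
  qed
  have "continuous_map X euclideanreal u"
  proof (rule continuous_map_locally_constant)
    fix x assume x: "x \<in> topspace X"
    with loc obtain N where N: "openin X N" "x \<in> N" "\<forall>y \<in> N. A y = A x" by blast
    have "u y = u x" if "y \<in> N" for y
    proof -
      have "A y = A x" "y \<in> topspace X" using that N openin_subset by blast+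
      then show ?thesis using x by (simp only: u_def restrict_apply')
    qed
    with N show "\<exists>N. openin X N \<and> x \<in> N \<and> (\<forall>y \<in> N. u y = u x)" by blast
  qed simp
  moreover have "countable (u ` topspace X)"
    \<comment> \<open>Without \<open>of_nat_sum\<close>, the sum remains the cast of a single
      natural number, which exhibits each value as \<open>1 / (1 + real n)\<close>.\<close>
    by (rule countable_subset[of _ "range (\<lambda>n. 1 / (1 + real n))"]) (auto simp: u_def simp del: of_nat_sum)
  ultimately have "u \<in> Cc X" by (simp add: Cc_def u_def)
  then have "Cc_pos_unit X u"
    by (rule Cc_pos_unitI) (simp add: u_def add_pos_nonneg del: of_nat_sum)
  moreover have "\<exists>x \<in> topspace X. u x < r" if r: "0 < r" for r
  proof -
    \<comment> \<open>Any point of \<open>V n\<close> has \<open>n\<close> among its indices, so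
      there \<open>u\<close> is at most \<open>1 / (1 + n)\<close>, which is below
      \<open>r\<close>.\<close>
    obtain n where n: "1 / r < real n" using reals_Archimedean2 by blast
    obtain x where x: "x \<in> V n" using V(3) by blast
    then have xX: "x \<in> topspace X" using openin_subset[OF V(1)] by blast
    have "n \<le> \<Sum>(A x)" using finA x by (intro member_le_sum) (auto simp: A_def)
    then have "1 / r < 1 + real (\<Sum>(A x))" using n by linarith
    then have "u x < r" using r xX
      by (simp add: u_def divide_less_eq mult.commute add_pos_nonneg del: of_nat_sum)
    with xX show ?thesis by blast
  qed
  ultimately show ?thesis using that by blast
qed

theorem theorem5p3:
  fixes X :: "'a topology"
  assumes "Hausdorff_space X"
    and "zero_dimensional_space X"
  shows "pseudocompact_space X \<longleftrightarrow>
         subtopology (mc_topology X) (Cc_star X) = uniform_norm_topology X"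
proof
  assume ps: "pseudocompact_space X"
  have "openin (uniform_norm_topology X) S"
    if S: "openin (subtopology (mc_topology X) (Cc_star X)) S" for S
    unfolding openin_uniform_norm_topology
  proof (intro conjI ballI)
    show "S \<subseteq> Cc_star X" using S by (simp add: openin_mc_subtopology)
    fix f assume "f \<in> S"
    with S obtain u where u: "Cc_pos_unit X u" "mc_basic X f u \<inter> Cc_star X \<subseteq> S"
      unfolding openin_mc_subtopology by blast
    \<comment> \<open>Replacing \<open>u\<close> by its lower bound \<open>r\<close> shrinks the
      neighbourhood to a uniform one.\<close>
    obtain r where r: "0 < r" "\<And>x. x \<in> topspace X \<Longrightarrow> r \<le> u x"
      using Cc_pos_unit_bounded_below[OF ps u(1)] by blast
    have "g \<in> S" if "g \<in> Cc_star X" "\<forall>x \<in> topspace X. \<bar>g x - f x\<bar> < r" for g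
      using that r u(2) by (force simp: mc_basic_def Cc_star_def)
    with r(1) show
      "\<exists>r > 0. \<forall>g \<in> Cc_star X. (\<forall>x \<in> topspace X. \<bar>g x - f x\<bar> < r) \<longrightarrow> g \<in> S"
      by blast
  qed
  then show "subtopology (mc_topology X) (Cc_star X) = uniform_norm_topology X"
    unfolding topology_eq using uniform_norm_topology_imp_mc by blast
next
  assume eq: "subtopology (mc_topology X) (Cc_star X) = uniform_norm_topology X"
  show "pseudocompact_space X"
  proof (rule ccontr)
    assume "\<not> pseudocompact_space X"
    then obtain u where u: "Cc_pos_unit X u" "\<And>r. 0 < r \<Longrightarrow> \<exists>x \<in> topspace X. u x < r"
      using Cc_pos_unit_arbitrarily_small assms(2) by blast
    let ?c = "\<lambda>c::real. restrict (\<lambda>_. c) (topspace X)"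
    have "openin (mc_topology X) (mc_basic X (?c 0) u)"
      unfolding openin_mc_topology
      by (rule arbitrary_union_of_inc) (use u(1) Cc_const in \<open>auto simp: mc_base_def\<close>)
    then have "openin (uniform_norm_topology X) (mc_basic X (?c 0) u \<inter> Cc_star X)"
      unfolding eq[symmetric] openin_subtopology by blast
    moreover have "?c 0 \<in> mc_basic X (?c 0) u \<inter> Cc_star X"
      using u(1) Cc_const[of 0 X] Cc_star_const[of 0 X]
      by (simp add: mc_basic_def Cc_pos_unit_def)
    ultimately obtain r :: real where r: "r > 0"
      "\<forall>g \<in> Cc_star X. (\<forall>x \<in> topspace X. \<bar>g x - ?c 0 x\<bar> < r)
         \<longrightarrow> g \<in> mc_basic X (?c 0) u \<inter> Cc_star X"
      unfolding openin_uniform_norm_topology by blast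
    \<comment> \<open>The constant \<open>r / 2\<close> is within \<open>r\<close> of
      \<open>0\<close>, so it lies in the neighbourhood given by \<open>u\<close>; this forces
      \<open>u\<close> above \<open>r / 2\<close> everywhere, although \<open>u\<close> takes
      arbitrarily small values.\<close>
    then have "?c (r / 2) \<in> mc_basic X (?c 0) u" using Cc_star_const[of "r / 2" X] by auto
    then have "\<forall>x \<in> topspace X. r / 2 < u x" using r(1) by (simp add: mc_basic_def)
    with u(2)[of "r / 2"] r(1) show False by force
  qed
qed

end
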